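(* There is an absolute constant $C>0$ such that the following holds. Let $\delta > 0$ and let $n$ be an integer with $n \geq \delta^{-2}$. Let $G$ be a graph on vertex set $[n]=\{1,\dots,n\}$ and let $(d_1,\dots,d_n)$ be a realizable sequence such that $$\sum_{i=1}^{n} |d_G(i) - d_i| \leq \delta n^2 .$$ Then there is a graph $G'$ on vertex set $[n]$ such that $|E(G') \triangle E(G)| \leq C\delta^{1/2} n^2$ and $d_{G'}(i) = d_i$ for every $i \in [n]$.
   Context: Graphs are finite, simple and undirected. $d_G(i)$ denotes the degree of vertex $i$ in $G$. A sequence $(d_1,\dots,d_n)$ of non-negative integers is realizable (graphic) if there is a graph $H$ on vertex set $[n]$ with $d_H(i)=d_i$ for all $i\in[n]$. $\triangle$ denotes symmetric difference. *)

theory Defs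
  imports Main Complex_Main
begin

definition is_graph_on :: "nat \<Rightarrow> nat set set \<Rightarrow> bool" where
  "is_graph_on n E \<longleftrightarrow> (\<forall>e\<in>E. e \<subseteq> {1..n} \<and> card e = 2)"

definition deg :: "nat set set \<Rightarrow> nat \<Rightarrow> nat" where
  "deg E i = card {e\<in>E. i \<in> e}"

definition realizable :: "nat \<Rightarrow> (nat \<Rightarrow> nat) \<Rightarrow> bool" where
  "realizable n d \<longleftrightarrow> (\<exists>H. is_graph_on n H \<and> (\<forall>i\<in>{1..n}. deg H i = d i))"

end

theory Submission
  imports Defs
begin

text \<open>
  View \<open>G\<close> as a symmetric digraph and let \<open>M\<close> be a loopless digraph with all in- and out-degrees
  equal to \<open>d\<close>, as close to \<open>G\<close> as possible. An alternating closed walk in the symmetric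
  difference could be switched to get closer to \<open>G\<close>, so the auxiliary digraph on two copies of the
  vertex set, with an arc from the tail copy to the head copy for every arc of \<open>M - G\<close> and in the
  opposite direction for every arc of \<open>G - M\<close>, is acyclic. Weigh an arc by the difference of the
  positions of its ends in a topological order. The total weight of the symmetric difference is
  controlled by the degree deviation, at most \<open>2n \<cdot> \<delta> n\<^sup>2\<close>, while only \<open>n (2t + 1)\<close> arcs have
  weight at most \<open>t\<close>; taking \<open>t = \<delta>\<^bsup>1/2\<^esup> n\<close> bounds the number of arcs.

  To make \<open>M\<close> symmetric, note that the set of its unreciprocated arcs has equal in- and out-degrees.
  Along an even closed trail these arcs can alternately be reciprocated and deleted without changing
  degrees; along an odd closed trail this creates a surplus or a deficit (as we like) of one at the
  initial vertex. As the degree sum is even, odd trails come in pairs, and one can adjust the edge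
  between the two initial vertices. The cost is at most twice the number of unreciprocated arcs,
  which is at most the distance from \<open>M\<close> to \<open>G\<close>.
\<close>

section \<open>Out-degrees of finite relations, with in-degrees as out-degrees of the
  converse\<close>

definition outdeg :: "'a rel \<Rightarrow> 'a \<Rightarrow> nat" where
  "outdeg R x = card (R `` {x})"

lemma finite_Image_singleton: "finite R \<Longrightarrow> finite (R `` {x})"
  by (simp add: finite_Image)

lemma outdeg_empty [simp]: "outdeg {} x = 0"
  by (simp add: outdeg_def)

lemma outdeg_Un_disjoint:
  assumes "finite A" "finite B" "A \<inter> B = {}"
  shows "outdeg (A \<union> B) x = outdeg A x + outdeg B x"
proof -
  have "(A \<union> B) `` {x} = A `` {x} \<union> B `` {x}" "A `` {x} \<inter> B `` {x} = {}"
    using assms(3) by auto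
  then show ?thesis
    unfolding outdeg_def using assms by (simp add: card_Un_disjoint finite_Image_singleton)
qed

lemma outdeg_insert:
  assumes "finite R" "(u, y) \<notin> R"
  shows "outdeg (insert (u, y) R) x = outdeg R x + of_bool (x = u)"
proof -
  have "outdeg {(u, y)} x = of_bool (x = u)"
    by (auto simp: outdeg_def Image_def)
  then show ?thesis
    using outdeg_Un_disjoint[of "{(u, y)}" R x] assms by simp
qed

lemma outdeg_converse_insert:
  assumes "finite R" "(u, y) \<notin> R"
  shows "outdeg ((insert (u, y) R)\<inverse>) x = outdeg (R\<inverse>) x + of_bool (x = y)"
proof -
  have "(insert (u, y) R)\<inverse> = insert (y, u) (R\<inverse>)" by auto
  then show ?thesis using outdeg_insert[of "R\<inverse>" y u x] assms by simp
qed

lemma outdeg_mono: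
  assumes "finite B" "A \<subseteq> B"
  shows "outdeg A x \<le> outdeg B x"
  unfolding outdeg_def using assms by (intro card_mono finite_Image_singleton) auto

lemma outdeg_Diff:
  assumes "finite B" "A \<subseteq> B"
  shows "outdeg (B - A) x + outdeg A x = outdeg B x"
proof -
  have "(B - A) \<union> A = B" "(B - A) \<inter> A = {}" using assms(2) by auto
  then show ?thesis
    using outdeg_Un_disjoint[of "B - A" A x] assms finite_subset[OF assms(2,1)] by simp
qed

lemma outdeg_pos:
  assumes "finite R" shows "outdeg R x > 0 \<longleftrightarrow> (\<exists>y. (x, y) \<in> R)"
  unfolding outdeg_def using assms by (auto simp: card_gt_0_iff finite_Image_singleton)

lemma sum_outdeg:
  assumes "finite V" "R \<subseteq> V \<times> V"
  shows "(\<Sum>x\<in>V. outdeg R x) = card R"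
proof -
  have "R = Sigma V (\<lambda>x. R `` {x})" using assms by auto
  then have "card R = card (Sigma V (\<lambda>x. R `` {x}))" by (rule arg_cong)
  moreover have "finite R" using assms by (meson finite_SigmaI finite_subset)
  ultimately show ?thesis
    unfolding outdeg_def using assms(1) by (simp add: card_SigmaI finite_Image_singleton)
qed

text \<open>Arcs pair off with their reverses; the linear order selects one arc of each pair.
  Applied to a graph, this is the handshake lemma.\<close>

lemma even_card_sym_irrefl:
  fixes R :: "'a::linorder rel"
  assumes "finite R" "sym R" "irrefl R"
  shows "even (card R)"
proof -
  define L where "L = {(x, y) \<in> R. x < y}"
  have R: "R = L \<union> L\<inverse>" "L \<inter> L\<inverse> = {}"
    using assms(2,3) unfolding L_def by (auto simp: irrefl_def dest: symD)
  have "finite L" using assms(1) R(1) by (metis finite_Un)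
  then have "card R = 2 * card L"
    using R by (metis card_Un_disjoint card_inverse finite_converse mult_2)
  then show ?thesis by simp
qed


section \<open>Trails\<close>

text \<open>Only the arc set is recorded, the traversal order being left to the derivation. Arcs may
  not repeat, vertices may.\<close>

inductive trail :: "'a \<Rightarrow> 'a \<Rightarrow> 'a rel \<Rightarrow> bool" where
  trail_nil: "trail u u {}"
| trail_cons: "trail y w T \<Longrightarrow> (u, y) \<notin> T \<Longrightarrow> trail u w (insert (u, y) T)"

lemma trail_finite: "trail u w T \<Longrightarrow> finite T"
  by (induction rule: trail.induct) auto

text \<open>Each passage through a vertex uses one arc in and one arc out, so only the ends need a
  correction. The corrections cancel for a closed trail.\<close>

lemma trail_outdeg:
  "trail u w T \<Longrightarrow> outdeg T x + of_bool (x = w) = outdeg (T\<inverse>) x + of_bool (x = u)"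
proof (induction rule: trail.induct)
  case (trail_cons y w T u)
  then show ?case
    using outdeg_insert[of T u y x] outdeg_converse_insert[of T u y x] trail_finite by fastforce
qed simp

lemma trail_append:
  "trail u v T \<Longrightarrow> trail v w T' \<Longrightarrow> T \<inter> T' = {} \<Longrightarrow> trail u w (T \<union> T')"
proof (induction rule: trail.induct)
  case (trail_cons y w' T u)
  then show ?case using trail.trail_cons[of y w "T \<union> T'" u] by auto
qed simp

lemma trail_single: "trail u y {(u, y)}"
  using trail_cons[OF trail_nil] by fastforce

text \<open>Cutting a trail at one of its vertices makes room for splicing in a further closed trail
  there. Either piece may be empty.\<close>

lemma trail_split:
  "trail u w T \<Longrightarrow> x \<in> Field T \<Longrightarrow>
    \<exists>T1 T2. T = T1 \<union> T2 \<and> T1 \<inter> T2 = {} \<and> trail u x T1 \<and> trail x w T2"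
proof (induction rule: trail.induct)
  case (trail_cons y w T u)
  have whole: "trail u w (insert (u, y) T)"
    using trail_cons by (simp add: trail.trail_cons)
  consider "x = u" | "x = y" | "x \<in> Field T"
    using trail_cons.prems by (auto simp: Field_def)
  then show ?case
  proof cases
    case 1
    show ?thesis
      by (rule exI[of _ "{}"], rule exI[of _ "insert (u, y) T"]) (use 1 whole trail_nil in auto)
  next
    case 2
    show ?thesis
      by (rule exI[of _ "{(u, y)}"], rule exI[of _ T])
        (use 2 trail_cons.hyps trail_single[of u y] in auto)
  next
    case 3
    then obtain T1 T2 where s: "T = T1 \<union> T2" "T1 \<inter> T2 = {}" "trail y x T1" "trail x w T2"
      using trail_cons.IH by blast
    show ?thesis
      by (rule exI[of _ "insert (u, y) T1"], rule exI[of _ T2])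
        (use s trail_cons.hyps trail.trail_cons[of y x T1 u] in auto)
  qed
qed simp

text \<open>The sets \<open>A\<close> and \<open>B\<close> consist of the arcs at alternating positions of the trail,
  with the first arc in \<open>A\<close>.\<close>

lemma trail_alternating:
  "trail u w T \<Longrightarrow> \<exists>A B. A \<union> B = T \<and> A \<inter> B = {} \<and>
    (if even (card T)
     then \<forall>x. outdeg (A\<inverse>) x = outdeg B x
        \<and> outdeg A x + of_bool (x = w) = outdeg (B\<inverse>) x + of_bool (x = u)
     else \<forall>x. outdeg (A\<inverse>) x = outdeg B x + of_bool (x = w)
        \<and> outdeg A x = outdeg (B\<inverse>) x + of_bool (x = u))"
proof (induction rule: trail.induct)
  case (trail_cons y w T u)
  from trail_cons.IH obtain A B where AB: "A \<union> B = T" "A \<inter> B = {}"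
    "if even (card T)
     then \<forall>x. outdeg (A\<inverse>) x = outdeg B x
        \<and> outdeg A x + of_bool (x = w) = outdeg (B\<inverse>) x + of_bool (x = y)
     else \<forall>x. outdeg (A\<inverse>) x = outdeg B x + of_bool (x = w)
        \<and> outdeg A x = outdeg (B\<inverse>) x + of_bool (x = y)"
    by (elim exE conjE) (rule that)
  have fin: "finite T" using trail_finite[OF trail_cons.hyps(1)] .
  then have finB: "finite B" "(u, y) \<notin> B" using AB(1) trail_cons.hyps by auto
  have card: "card (insert (u, y) T) = Suc (card T)" using fin trail_cons.hyps by simp
  show ?case
  \<comment> \<open>Prepending an arc shifts all positions by one, so the two classes change places
    and the new arc joins the old \<open>B\<close>.\<close>
  proof (rule exI[of _ "insert (u, y) B"], rule exI[of _ A], intro conjI)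
    show "insert (u, y) B \<union> A = insert (u, y) T" using AB(1) by auto
    show "insert (u, y) B \<inter> A = {}" using AB(1,2) trail_cons.hyps(2) by auto
    show "if even (card (insert (u, y) T))
     then \<forall>x. outdeg ((insert (u, y) B)\<inverse>) x = outdeg A x
        \<and> outdeg (insert (u, y) B) x + of_bool (x = w) = outdeg (A\<inverse>) x + of_bool (x = u)
     else \<forall>x. outdeg ((insert (u, y) B)\<inverse>) x = outdeg A x + of_bool (x = w)
        \<and> outdeg (insert (u, y) B) x = outdeg (A\<inverse>) x + of_bool (x = u)"
      unfolding card outdeg_insert[OF finB] outdeg_converse_insert[OF finB]
      using AB(3)
      by (cases "even (card T)") (simp_all only: even_Suc if_True if_False ac_simps simp_thms)
  qed
qed auto

section \<open>Closed trails in balanced digraphs\<close>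

lemma balanced_Diff_closed_trail:
  assumes "finite S" "\<And>x. outdeg S x = outdeg (S\<inverse>) x" "trail u u T" "T \<subseteq> S"
  shows "outdeg (S - T) x = outdeg ((S - T)\<inverse>) x"
proof -
  have "outdeg T x = outdeg (T\<inverse>) x" using trail_outdeg[OF assms(3), of x] by simp
  moreover have "(S - T)\<inverse> = S\<inverse> - T\<inverse>" by auto
  ultimately show ?thesis
    using outdeg_Diff[OF assms(1,4), of x] outdeg_Diff[of "S\<inverse>" "T\<inverse>" x] assms by simp
qed

lemma balanced_closed_trail:
  assumes fin: "finite S" and bal: "\<And>x. outdeg S x = outdeg (S\<inverse>) x" and ab: "(a, b) \<in> S"
  shows "\<exists>T. T \<noteq> {} \<and> T \<subseteq> S \<and> trail a a T"
proof -
  define P where "P T \<longleftrightarrow> T \<subseteq> S \<and> (\<exists>w. trail a w T)" for T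
  have "P {(a, b)}" unfolding P_def using ab trail_single by fastforce
  moreover have "\<forall>T. P T \<longrightarrow> card T < Suc (card S)"
    unfolding P_def using fin by (simp add: card_mono less_Suc_eq_le)
  ultimately obtain T where T: "P T" "\<And>T'. P T' \<Longrightarrow> card T' \<le> card T"
    using ex_has_greatest_nat[of P "{(a, b)}" card "Suc (card S)"] by blast
  then obtain w where w: "trail a w T" "T \<subseteq> S" unfolding P_def by blast
  have "card T \<ge> 1" using T(2)[OF \<open>P {(a, b)}\<close>] by simp
  then have "T \<noteq> {}" by auto
  moreover have "w = a"
  proof (rule ccontr)
    assume "w \<noteq> a"
    then have "outdeg T w < outdeg (T\<inverse>) w" using trail_outdeg[OF w(1), of w] by simp
    also have "\<dots> \<le> outdeg (S\<inverse>) w" using w(2) fin by (intro outdeg_mono) auto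
    also have "\<dots> = outdeg S w" using bal by simp
    finally have "outdeg (S - T) w > 0" using outdeg_Diff[OF fin w(2), of w] by simp
    then obtain z where z: "(w, z) \<in> S" "(w, z) \<notin> T"
      using outdeg_pos[of "S - T" w] fin by auto
    then have "P (T \<union> {(w, z)})"
      unfolding P_def using w trail_append[OF w(1) trail_single[of w z]] by auto
    from T(2)[OF this] show False using z trail_finite[OF w(1)] by simp
  qed
  ultimately show ?thesis using w by blast
qed

text \<open>Take a closed trail with the most arcs. If it met a vertex of the remaining digraph,
  which is again balanced, a closed trail of the rest through that vertex could be spliced in. The
  isolation later ensures that no arc of \<open>S\<close> joins the two chosen base points.\<close>

lemma isolated_closed_trail:
  assumes fin: "finite S" and bal: "\<And>x. outdeg S x = outdeg (S\<inverse>) x" and ne: "S \<noteq> {}"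
  shows "\<exists>u T. T \<noteq> {} \<and> T \<subseteq> S \<and> trail u u T \<and> Field T \<inter> Field (S - T) = {}"
proof -
  define P where "P T \<longleftrightarrow> T \<subseteq> S \<and> T \<noteq> {} \<and> (\<exists>u. trail u u T)" for T
  obtain a b where "(a, b) \<in> S" using ne by auto
  from balanced_closed_trail[OF fin bal this] obtain T0 where "P T0" unfolding P_def by blast
  moreover have "\<forall>T. P T \<longrightarrow> card T < Suc (card S)"
    unfolding P_def using fin by (simp add: card_mono less_Suc_eq_le)
  ultimately obtain T where T: "P T" "\<And>T'. P T' \<Longrightarrow> card T' \<le> card T"
    using ex_has_greatest_nat[of P T0 card "Suc (card S)"] by blast
  then obtain u where u: "trail u u T" "T \<subseteq> S" "T \<noteq> {}" unfolding P_def by blast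
  have "Field T \<inter> Field (S - T) = {}"
  proof (rule ccontr)
    assume "Field T \<inter> Field (S - T) \<noteq> {}"
    then obtain w where w: "w \<in> Field T" "w \<in> Field (S - T)" by blast
    have bal': "outdeg (S - T) x = outdeg ((S - T)\<inverse>) x" for x
      using balanced_Diff_closed_trail[OF fin bal u(1,2)] .
    have "outdeg (S - T) w > 0"
      using w(2) bal'[of w] outdeg_pos[of "S - T" w] outdeg_pos[of "(S - T)\<inverse>" w] fin
      by (auto simp: Field_def)
    then obtain b where wb: "(w, b) \<in> S - T" using outdeg_pos[of "S - T" w] fin by auto
    have "finite (S - T)" using fin by simp
    from balanced_closed_trail[OF this bal' wb]
    obtain T' where T': "T' \<noteq> {}" "T' \<subseteq> S - T" "trail w w T'" by blast
    obtain T1 T2 where s: "T = T1 \<union> T2" "T1 \<inter> T2 = {}" "trail u w T1" "trail w u T2"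
      using trail_split[OF u(1) w(1)] by blast
    have "trail w u (T' \<union> T2)" using trail_append[OF T'(3) s(4)] T' s by blast
    then have "trail u u (T1 \<union> (T' \<union> T2))" using trail_append[OF s(3)] T' s by blast
    moreover have eq: "T1 \<union> (T' \<union> T2) = T \<union> T'" using s(1) by blast
    ultimately have "P (T \<union> T')" unfolding P_def using u T' by auto
    from T(2)[OF this] have "card (T \<union> T') \<le> card T" .
    moreover have "card (T \<union> T') = card T + card T'"
      using T' trail_finite[OF u(1)] trail_finite[OF T'(3)] by (intro card_Un_disjoint) auto
    moreover have "card T' > 0" using T' trail_finite[OF T'(3)] by (simp add: card_gt_0_iff)
    ultimately show False by simp
  qed
  with u show ?thesis by blast
qed


section \<open>Symmetrising a digraph with equal in- and out-degrees\<close>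

text \<open>A directed relaxation of realizability: symmetry is dropped, but in- and out-degrees are
  both prescribed.\<close>

definition realizes :: "'a set \<Rightarrow> ('a \<Rightarrow> nat) \<Rightarrow> 'a rel \<Rightarrow> bool" where
  "realizes V d M \<longleftrightarrow> M \<subseteq> V \<times> V \<and> irrefl M \<and>
     (\<forall>x\<in>V. outdeg M x = d x \<and> outdeg (M\<inverse>) x = d x)"

lemma outdeg_exchange:
  assumes "finite M" "finite Q" "R \<subseteq> M" "Q \<inter> M = {}"
  shows "outdeg ((M - R) \<union> Q) x + outdeg R x = outdeg M x + outdeg Q x"
proof -
  have "outdeg ((M - R) \<union> Q) x = outdeg (M - R) x + outdeg Q x"
    using assms by (intro outdeg_Un_disjoint) auto
  then show ?thesis using outdeg_Diff[OF assms(1,3), of x] by simp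
qed

lemma outdeg_converse_exchange:
  assumes "finite M" "finite Q" "R \<subseteq> M" "Q \<inter> M = {}"
  shows "outdeg (((M - R) \<union> Q)\<inverse>) x + outdeg (R\<inverse>) x = outdeg (M\<inverse>) x + outdeg (Q\<inverse>) x"
proof -
  have "((M - R) \<union> Q)\<inverse> = (M\<inverse> - R\<inverse>) \<union> Q\<inverse>" by auto
  then show ?thesis using outdeg_exchange[of "M\<inverse>" "Q\<inverse>" "R\<inverse>" x] assms by auto
qed

text \<open>Arcs of \<open>A\<close> are reciprocated, arcs of \<open>B\<close> deleted.\<close>

definition rounding :: "'a rel \<Rightarrow> 'a rel \<Rightarrow> 'a rel \<Rightarrow> 'a rel" where
  "rounding M A B = (M - B) \<union> A\<inverse>"

text \<open>Since \<open>A\<close> and \<open>B\<close> are disjoint sets of unreciprocated arcs,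
  the arcs of \<open>A\<inverse>\<close> are new and the two operations do not interfere. Every
  treated arc leaves the asymmetric part. Degrees are stated additively to avoid truncated
  subtraction.\<close>

lemma rounding:
  assumes fin: "finite M" and A: "A \<subseteq> M - M\<inverse>" and B: "B \<subseteq> M - M\<inverse>" and AB: "A \<inter> B = {}"
  shows rounding_asym: "rounding M A B - (rounding M A B)\<inverse> = (M - M\<inverse>) - (A \<union> B)"
    and rounding_diff: "sym_diff (rounding M A B) M = A\<inverse> \<union> B"
    and rounding_outdeg: "outdeg (rounding M A B) x + outdeg B x = outdeg M x + outdeg (A\<inverse>) x"
    and rounding_indeg:
      "outdeg ((rounding M A B)\<inverse>) x + outdeg (B\<inverse>) x = outdeg (M\<inverse>) x + outdeg A x"
proof -
  have "finite A" using fin A by (meson Diff_subset finite_subset)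
  then show "outdeg (rounding M A B) x + outdeg B x = outdeg M x + outdeg (A\<inverse>) x"
    "outdeg ((rounding M A B)\<inverse>) x + outdeg (B\<inverse>) x = outdeg (M\<inverse>) x + outdeg A x"
    unfolding rounding_def
    using outdeg_exchange[of M "A\<inverse>" B x] outdeg_converse_exchange[of M "A\<inverse>" B x] fin A B by auto
  have mem: "(x, y) \<in> A \<Longrightarrow> (x, y) \<in> M \<and> (y, x) \<notin> M \<and> (x, y) \<notin> B"
    "(x, y) \<in> B \<Longrightarrow> (x, y) \<in> M \<and> (y, x) \<notin> M" for x y
    using A B AB by auto
  have "(x, y) \<in> rounding M A B - (rounding M A B)\<inverse> \<longleftrightarrow> (x, y) \<in> (M - M\<inverse>) - (A \<union> B)" for x y
    unfolding rounding_def using mem[of x y] mem[of y x] by auto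
  then show "rounding M A B - (rounding M A B)\<inverse> = (M - M\<inverse>) - (A \<union> B)"
    by (intro set_eqI) (simp only: split_paired_all)
  have "(x, y) \<in> sym_diff (rounding M A B) M \<longleftrightarrow> (x, y) \<in> A\<inverse> \<union> B" for x y
    unfolding rounding_def using mem[of x y] mem[of y x] by auto
  then show "sym_diff (rounding M A B) M = A\<inverse> \<union> B"
    by (intro set_eqI) (simp only: split_paired_all)
qed

lemma even_card_asym:
  fixes M :: "'a::linorder rel"
  assumes "finite M" "irrefl M"
  shows "even (card (M - M\<inverse>)) \<longleftrightarrow> even (card M)"
proof -
  have "even (card (M \<inter> M\<inverse>))"
    using assms by (intro even_card_sym_irrefl) (auto simp: sym_def irrefl_def)
  moreover have "card M = card (M \<inter> M\<inverse>) + card (M - M\<inverse>)"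
    using card_Un_disjoint[of "M \<inter> M\<inverse>" "M - M\<inverse>"] assms(1)
    by (simp add: Int_Diff_disjoint Int_Diff_Un)
  ultimately show ?thesis by simp
qed

lemma realizes_finite: "finite V \<Longrightarrow> realizes V d M \<Longrightarrow> finite M"
  unfolding realizes_def by (meson finite_SigmaI finite_subset)

lemma realizes_asym_balanced:
  assumes "finite V" "realizes V d M"
  shows "outdeg (M - M\<inverse>) x = outdeg ((M - M\<inverse>)\<inverse>) x"
proof -
  have fin: "finite M" using realizes_finite[OF assms] .
  have eq: "outdeg M x = outdeg (M\<inverse>) x"
  proof (cases "x \<in> V")
    case True
    then show ?thesis using assms by (simp add: realizes_def)
  next
    case False
    then have "M `` {x} = {}" "M\<inverse> `` {x} = {}" using assms by (auto simp: realizes_def)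
    then show ?thesis by (simp add: outdeg_def)
  qed
  have 1: "M - M\<inverse> = M - M \<inter> M\<inverse>" "(M - M\<inverse>)\<inverse> = M\<inverse> - M \<inter> M\<inverse>" by auto
  show ?thesis
    unfolding 1(2) unfolding 1(1) using outdeg_Diff[of M "M \<inter> M\<inverse>" x] outdeg_Diff[of "M\<inverse>" "M \<inter> M\<inverse>" x] fin eq by simp
qed

text \<open>The inequality charges each change to the asymmetric arcs it eliminates, at most two
  changes per arc, so that it telescopes when the step is iterated.\<close>

lemma symmetrise_step:
  fixes M :: "'a::linorder rel"
  assumes V: "finite V" and M: "realizes V d M" and ev: "even (\<Sum>x\<in>V. d x)"
    and ne: "M - M\<inverse> \<noteq> {}"
  shows "\<exists>M'. realizes V d M' \<and> M' - M'\<inverse> \<subset> M - M\<inverse> \<and>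
    card (sym_diff M' M) + 2 * card (M' - M'\<inverse>) \<le> 2 * card (M - M\<inverse>)"
proof -
  define S where "S = M - M\<inverse>"
  have fin: "finite M" using realizes_finite[OF V M] .
  then have finS: "finite S" by (simp add: S_def)
  have MV: "M \<subseteq> V \<times> V" "irrefl M" and
    Md: "\<And>x. x \<in> V \<Longrightarrow> outdeg M x = d x" "\<And>x. x \<in> V \<Longrightarrow> outdeg (M\<inverse>) x = d x"
    using M by (auto simp: realizes_def)
  have bal: "outdeg S x = outdeg (S\<inverse>) x" for x
    unfolding S_def using realizes_asym_balanced[OF V M] .
  have round_ok: "rounding N A B \<subseteq> V \<times> V \<and> irrefl (rounding N A B)"
    if "N \<subseteq> V \<times> V" "irrefl N" "A \<subseteq> N" for N A B
    using that unfolding rounding_def irrefl_def by auto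
  \<comment> \<open>On an even closed trail, reciprocating one alternating class and deleting the
    other cancel at every vertex, including the base point.\<close>
  have even_case: ?thesis if T: "T \<noteq> {}" "T \<subseteq> S" "trail u u T" "even (card T)" for u T
  proof -
    obtain A B where AB: "A \<union> B = T" "A \<inter> B = {}"
      "\<And>x. outdeg (A\<inverse>) x = outdeg B x" "\<And>x. outdeg A x = outdeg (B\<inverse>) x"
      using trail_alternating[OF T(3)] T(4) by auto
    have sub: "A \<subseteq> M - M\<inverse>" "B \<subseteq> M - M\<inverse>" using AB(1) T(2) by (auto simp: S_def)
    note r = rounding[OF fin sub AB(2)]
    let ?M = "rounding M A B"
    have "realizes V d ?M"
      unfolding realizes_def using round_ok[of M A B] MV sub r(3,4) AB(3,4) Md by fastforce
    moreover have S': "?M - ?M\<inverse> = S - T" using r(1) AB(1) by (simp add: S_def)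
    moreover have "S - T \<subset> S" using T by blast
    moreover have "card (sym_diff ?M M) \<le> card T"
    proof -
      have "card (sym_diff ?M M) \<le> card (A\<inverse>) + card B" unfolding r(2) by (rule card_Un_le)
      also have "\<dots> = card T"
        using AB finS T(2) card_Un_disjoint[of A B]
        by (metis card_inverse finite_Un finite_subset)
      finally show ?thesis .
    qed
    moreover have "card (S - T) = card S - card T" "card T \<le> card S"
      using T(2) finS by (auto simp: card_Diff_subset finite_subset card_mono)
    ultimately show ?thesis unfolding S_def[symmetric] by (intro exI[of _ ?M]) auto
  qed
  \<comment> \<open>An odd closed trail has its first and last arc in the same class, which leaves
    an imbalance of one at the base point. Exchanging the roles of the classes changes its sign:
    \<open>s\<close> asks for a deficit, \<open>\<not> s\<close> for a surplus.\<close>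
  have odd_split: "\<exists>A B. A \<union> B = T \<and> A \<inter> B = {} \<and>
      (\<forall>x. outdeg (A\<inverse>) x + of_bool (s \<and> x = u) = outdeg B x + of_bool (\<not> s \<and> x = u)) \<and>
      (\<forall>x. outdeg A x + of_bool (s \<and> x = u) = outdeg (B\<inverse>) x + of_bool (\<not> s \<and> x = u))"
    if T: "trail u u T" "odd (card T)" for u T and s :: bool
  proof -
    obtain A B where AB: "A \<union> B = T" "A \<inter> B = {}"
      "\<And>x. outdeg (A\<inverse>) x = outdeg B x + of_bool (x = u)"
      "\<And>x. outdeg A x = outdeg (B\<inverse>) x + of_bool (x = u)"
      using trail_alternating[OF T(1)] T(2) by auto
    show ?thesis
    proof (cases s)
      case True
      show ?thesis by (rule exI[of _ B], rule exI[of _ A]) (use True AB in auto)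
    next
      case False
      show ?thesis by (rule exI[of _ A], rule exI[of _ B]) (use False AB in auto)
    qed
  qed
  obtain u T where T: "T \<noteq> {}" "T \<subseteq> S" "trail u u T" "Field T \<inter> Field (S - T) = {}"
    using isolated_closed_trail[OF finS bal] ne S_def by blast
  show ?thesis
  proof (cases "even (card T)")
    case True
    then show ?thesis using even_case[OF T(1-3)] by blast
  next
    case oddT: False
    have cT: "card (S - T) = card S - card T" "card T \<le> card S"
      using T(2) finS by (auto simp: card_Diff_subset finite_subset card_mono)
    \<comment> \<open>Parity of the degree sum passes to \<open>S\<close>, because the reciprocated
      arcs are even in number. Hence an odd \<open>T\<close> cannot exhaust \<open>S\<close>, and a
      second trail exists.\<close>
    have "even (card S)"
    proof -
      have "card M = (\<Sum>x\<in>V. d x)" using sum_outdeg[OF V MV(1)] Md(1) by simp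
      then show ?thesis using even_card_asym[OF fin MV(2)] ev by (simp add: S_def)
    qed
    then have "S - T \<noteq> {}" using oddT T(2) by (metis Diff_eq_empty_iff subset_antisym)
    then obtain v b where vb: "(v, b) \<in> S - T" by auto
    have "finite (S - T)" using finS by simp
    from balanced_closed_trail[OF this balanced_Diff_closed_trail[OF finS bal T(3,2)] vb]
    obtain T' where T': "T' \<noteq> {}" "T' \<subseteq> S - T" "trail v v T'" by blast
    show ?thesis
    proof (cases "even (card T')")
      case True
      moreover have "T' \<subseteq> S" using T'(2) by blast
      ultimately show ?thesis using even_case[OF T'(1) _ T'(3)] by blast
    next
      case oddT': False
      have uT: "u \<in> Field T"
        using T(3,1) by cases (auto simp: Field_def)
      have vT: "v \<in> Field (S - T)" using vb by (auto simp: Field_def)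
      have uv: "u \<noteq> v" using uT vT T(4) by blast
      \<comment> \<open>An arc of \<open>S\<close> between \<open>u\<close> and \<open>v\<close>
        would lie in \<open>T\<close> or in \<open>S - T\<close>, and would put both vertices in the
        same field, against isolation. So \<open>u\<close> and \<open>v\<close> are joined in
        \<open>M\<close> in both directions or in neither.\<close>
      have nS: "(u, v) \<notin> S" "(v, u) \<notin> S"
        using uT vT T(4) by (blast intro: FieldI1 FieldI2)+
      have uvV: "u \<in> V" "v \<in> V"
        using uT vT T(2) MV(1) by (auto simp: Field_def S_def)
      \<comment> \<open>If \<open>uv\<close> is a non-edge it will be added, so both trails are rounded to a deficit at \<open>u\<close>
        and \<open>v\<close>; otherwise it is deleted and they are rounded to a surplus.\<close>
      define s where "s \<longleftrightarrow> (u, v) \<notin> M"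
      have s: "s \<longleftrightarrow> (v, u) \<notin> M" using nS by (auto simp: s_def S_def)
      obtain A B where AB: "A \<union> B = T" "A \<inter> B = {}"
        "\<And>x. outdeg (A\<inverse>) x + of_bool (s \<and> x = u) = outdeg B x + of_bool (\<not> s \<and> x = u)"
        "\<And>x. outdeg A x + of_bool (s \<and> x = u) = outdeg (B\<inverse>) x + of_bool (\<not> s \<and> x = u)"
        using odd_split[OF T(3) oddT, of s] by blast
      obtain A' B' where AB': "A' \<union> B' = T'" "A' \<inter> B' = {}"
        "\<And>x. outdeg (A'\<inverse>) x + of_bool (s \<and> x = v) = outdeg B' x + of_bool (\<not> s \<and> x = v)"
        "\<And>x. outdeg A' x + of_bool (s \<and> x = v) = outdeg (B'\<inverse>) x + of_bool (\<not> s \<and> x = v)"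
        using odd_split[OF T'(3) oddT', of s] by blast
      define M1 where "M1 = rounding M A B"
      have sub: "A \<subseteq> M - M\<inverse>" "B \<subseteq> M - M\<inverse>" using AB(1) T(2) by (auto simp: S_def)
      note r1 = rounding[OF fin sub AB(2), folded M1_def]
      have S1: "M1 - M1\<inverse> = S - T" using r1(1) AB(1) by (simp add: S_def)
      have M1V: "M1 \<subseteq> V \<times> V" "irrefl M1" using round_ok[of M A B] MV sub by (auto simp: M1_def)
      have fin1: "finite M1" using M1V(1) V by (meson finite_SigmaI finite_subset)
      define M2 where "M2 = rounding M1 A' B'"
      have sub': "A' \<subseteq> M1 - M1\<inverse>" "B' \<subseteq> M1 - M1\<inverse>" using AB'(1) T'(2) S1 by auto
      note r2 = rounding[OF fin1 sub' AB'(2), folded M2_def]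
      have S2: "M2 - M2\<inverse> = S - T - T'" using r2(1) AB'(1) S1 by simp
      have M2V: "M2 \<subseteq> V \<times> V" "irrefl M2"
        using round_ok[of M1 A' B'] M1V sub' by (auto simp: M2_def)
      have fin2: "finite M2" using M2V(1) V by (meson finite_SigmaI finite_subset)
      have finAB: "finite A" "finite B" "finite A'" "finite B'"
        using AB(1) AB'(1) trail_finite[OF T(3)] trail_finite[OF T'(3)] by auto
      have TS: "A \<subseteq> S" "B \<subseteq> S" "A' \<subseteq> S" "B' \<subseteq> S" using AB(1) AB'(1) T(2) T'(2) by auto
      \<comment> \<open>Both roundings touch only arcs of \<open>S\<close> and their reverses, so
        the status of \<open>uv\<close> is still that in \<open>M\<close>.\<close>
      have uv2: "(u, v) \<in> M2 \<longleftrightarrow> \<not> s" "(v, u) \<in> M2 \<longleftrightarrow> \<not> s"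
        using s s_def nS TS unfolding M2_def M1_def rounding_def by blast+
      define Q where "Q = {(u, v), (v, u)}"
      have Qdeg: "outdeg Q x = of_bool (x = u) + of_bool (x = v)" "Q\<inverse> = Q" for x
        unfolding Q_def using uv by (auto simp: outdeg_insert)
      define M3 where "M3 = (if s then M2 \<union> Q else M2 - Q)"
      have deg3: "outdeg M3 x = d x" "outdeg (M3\<inverse>) x = d x" if "x \<in> V" for x
      proof -
        have e: "outdeg M3 x + of_bool (\<not> s) * outdeg Q x = outdeg M2 x + of_bool s * outdeg Q x"
          "outdeg (M3\<inverse>) x + of_bool (\<not> s) * outdeg Q x = outdeg (M2\<inverse>) x + of_bool s * outdeg Q x"
          using outdeg_exchange[of M2 "{}" Q x] outdeg_converse_exchange[of M2 "{}" Q x]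
            outdeg_exchange[of M2 Q "{}" x] outdeg_converse_exchange[of M2 Q "{}" x] fin2 uv2 Qdeg(2)
          unfolding M3_def by (auto simp: Q_def)
        show "outdeg M3 x = d x"
          using e(1) r1(3)[of x] r2(3)[of x] AB(3)[of x] AB'(3)[of x] Md(1)[OF that] Qdeg(1)[of x]
          by (cases s) auto
        show "outdeg (M3\<inverse>) x = d x"
          using e(2) r1(4)[of x] r2(4)[of x] AB(4)[of x] AB'(4)[of x] Md(2)[OF that] Qdeg(1)[of x]
          by (cases s) auto
      qed
      have "realizes V d M3"
        unfolding realizes_def using deg3 M2V uvV uv
        by (auto simp: M3_def Q_def irrefl_def)
      moreover have S3: "M3 - M3\<inverse> = S - T - T'"
        unfolding S2[symmetric] M3_def using uv2 by (auto simp: Q_def)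
      moreover have "S - T - T' \<subset> S" using T by blast
      moreover have "card (sym_diff M3 M) \<le> card T + card T' + 2"
      proof -
        have "sym_diff M3 M \<subseteq> (A\<inverse> \<union> B) \<union> (A'\<inverse> \<union> B') \<union> Q"
          unfolding r1(2)[symmetric] r2(2)[symmetric] M3_def by auto
        then have "card (sym_diff M3 M) \<le> card ((A\<inverse> \<union> B) \<union> (A'\<inverse> \<union> B') \<union> Q)"
          using finAB by (intro card_mono) (auto simp: Q_def)
        also have "\<dots> \<le> (card (A\<inverse>) + card B) + (card (A'\<inverse>) + card B') + card Q"
          by (meson card_Un_le add_mono order_trans order_refl)
        also have "\<dots> = card T + card T' + 2"
          using AB(1,2) AB'(1,2) finAB uv card_Un_disjoint[of A B] card_Un_disjoint[of A' B']
          by (simp add: Q_def)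
        finally show ?thesis .
      qed
      moreover have "card (S - T - T') + card T + card T' = card S"
        using cT T'(2) finS trail_finite[OF T'(3)] card_mono[of "S - T" T']
        by (simp add: card_Diff_subset)
      \<comment> \<open>This pays for the two extra arcs of \<open>Q\<close>:
        \<open>card T + card T' + 2\<close> is at most twice
        \<open>card T + card T'\<close>.\<close>
      moreover have "card T \<ge> 1" "card T' \<ge> 1"
        using oddT oddT' by (auto simp: Suc_le_eq intro: odd_pos)
      ultimately show ?thesis unfolding S_def[symmetric] by (intro exI[of _ M3]) auto
    qed
  qed
qed

lemma card_sym_diff_triangle:
  assumes "finite A" "finite B" "finite C"
  shows "card (sym_diff A C) \<le> card (sym_diff A B) + card (sym_diff B C)"
proof -
  have "card (sym_diff A C) \<le> card (sym_diff A B \<union> sym_diff B C)"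
    using assms by (intro card_mono) auto
  then show ?thesis using card_Un_le order_trans by blast
qed

lemma symmetrise:
  fixes M :: "'a::linorder rel"
  assumes V: "finite V" and M: "realizes V d M" and ev: "even (\<Sum>x\<in>V. d x)"
  shows "\<exists>M'. realizes V d M' \<and> sym M' \<and> card (sym_diff M' M) \<le> 2 * card (M - M\<inverse>)"
  using M
proof (induction "card (M - M\<inverse>)" arbitrary: M rule: less_induct)
  case less
  show ?case
  proof (cases "M - M\<inverse> = {}")
    case True
    then have "sym M" by (auto simp: sym_def)
    then show ?thesis using less.prems by (intro exI[of _ M]) auto
  next
    case False
    then obtain M1 where M1: "realizes V d M1" "M1 - M1\<inverse> \<subset> M - M\<inverse>"
      "card (sym_diff M1 M) + 2 * card (M1 - M1\<inverse>) \<le> 2 * card (M - M\<inverse>)"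
      using symmetrise_step[OF V less.prems ev] by blast
    have fin: "finite M" "finite M1" using realizes_finite[OF V] less.prems M1(1) by auto
    then have "card (M1 - M1\<inverse>) < card (M - M\<inverse>)"
      using M1(2) by (intro psubset_card_mono) auto
    then obtain M' where M': "realizes V d M'" "sym M'"
      "card (sym_diff M' M1) \<le> 2 * card (M1 - M1\<inverse>)"
      using less.hyps M1(1) by blast
    moreover have "card (sym_diff M' M) \<le> card (sym_diff M' M1) + card (sym_diff M1 M)"
      using realizes_finite[OF V M'(1)] fin by (intro card_sym_diff_triangle) auto
    ultimately show ?thesis using M1(3) by (intro exI[of _ M']) auto
  qed
qed

text \<open>As \<open>G\<close> contains both or neither of two opposite arcs, it disagrees with
  \<open>M\<close> on at least one of them whenever \<open>M\<close> contains exactly one. The map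
  \<open>f\<close> selects such a disagreement.\<close>

lemma card_asym_le_sym_diff:
  assumes "finite M" "finite G" "sym G"
  shows "card (M - M\<inverse>) \<le> card (sym_diff M G)"
proof -
  define f where "f a = (if a \<in> G then prod.swap a else a)" for a :: "'a \<times> 'a"
  have "inj_on f (M - M\<inverse>)" unfolding f_def by (rule inj_onI) (auto split: if_splits)
  moreover have "f ` (M - M\<inverse>) \<subseteq> sym_diff M G"
    using assms(3) unfolding f_def by (auto dest: symD)
  ultimately show ?thesis using assms by (meson card_inj_on_le finite_Diff finite_UnI)
qed


section \<open>Closest digraph and its potential\<close>

text \<open>A smallest nonempty invariant subset is mapped onto itself. For a successor function
  this extracts cycles.\<close>

lemma finite_self_map_bij:
  assumes "finite X" "X \<noteq> {}" "f ` X \<subseteq> X"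
  shows "\<exists>Y\<subseteq>X. Y \<noteq> {} \<and> bij_betw f Y Y"
proof -
  define P where "P Y \<longleftrightarrow> Y \<subseteq> X \<and> Y \<noteq> {} \<and> f ` Y \<subseteq> Y" for Y
  have "P X" using assms by (simp add: P_def)
  then obtain Y where Y: "P Y" "\<And>Z. P Z \<Longrightarrow> card Y \<le> card Z"
    using ex_has_least_nat[of P X card] by blast
  then have "P (f ` Y)" unfolding P_def by blast
  then have "card Y \<le> card (f ` Y)" using Y by blast
  moreover have "finite Y" "f ` Y \<subseteq> Y" using Y(1) assms by (auto simp: P_def finite_subset)
  ultimately have "f ` Y = Y" by (simp add: card_seteq)
  then have "bij_betw f Y Y"
    using \<open>finite Y\<close> by (simp add: bij_betw_def finite_surj_inj)
  then show ?thesis using Y(1) P_def by blast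
qed

text \<open>The hypothesis, a sink in every nonempty subset, is acyclicity in finite form. A sink of
  \<open>V\<close> receives the largest label and the rest is ordered by induction.\<close>

lemma topological_order:
  assumes "finite V" "\<And>X. X \<subseteq> V \<Longrightarrow> X \<noteq> {} \<Longrightarrow> \<exists>x\<in>X. \<forall>y\<in>X. (x, y) \<notin> D"
  shows "\<exists>p :: 'a \<Rightarrow> nat. inj_on p V \<and> (\<forall>x\<in>V. p x < card V) \<and>
    (\<forall>x\<in>V. \<forall>y\<in>V. (x, y) \<in> D \<longrightarrow> p x < p y)"
  using assms
proof (induction "card V" arbitrary: V)
  case 0
  then show ?case by auto
next
  case (Suc k)
  then have "V \<noteq> {}" by auto
  then obtain x where x: "x \<in> V" "\<forall>y\<in>V. (x, y) \<notin> D" using Suc.prems(2)[of V] by blast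
  have k: "k = card (V - {x})" using Suc x by simp
  have "\<exists>p :: 'a \<Rightarrow> nat. inj_on p (V - {x}) \<and> (\<forall>z\<in>V - {x}. p z < card (V - {x})) \<and>
    (\<forall>z\<in>V - {x}. \<forall>y\<in>V - {x}. (z, y) \<in> D \<longrightarrow> p z < p y)"
    using Suc.prems by (intro Suc.hyps(1)[OF k]) (auto intro!: Suc.prems(2))
  then obtain p :: "'a \<Rightarrow> nat" where p: "inj_on p (V - {x})" "\<forall>z\<in>V - {x}. p z < k"
    "\<forall>z\<in>V - {x}. \<forall>y\<in>V - {x}. (z, y) \<in> D \<longrightarrow> p z < p y"
    unfolding k by blast
  have "inj_on (p(x := k)) V"
    using p(1,2) unfolding inj_on_def by (metis Diff_iff fun_upd_apply less_irrefl singletonD)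
  moreover have "\<forall>z\<in>V. (p(x := k)) z < card V"
    using p(2) by (auto simp flip: Suc.hyps(2) intro: less_SucI)
  moreover have "\<forall>z\<in>V. \<forall>y\<in>V. (z, y) \<in> D \<longrightarrow> (p(x := k)) z < (p(x := k)) y"
    using p(2,3) x by auto
  ultimately show ?case by blast
qed

lemma closest_realization_potential:
  fixes d :: "'a \<Rightarrow> nat" and G :: "'a rel"
  assumes V: "finite V" and M: "realizes V d M" and G: "G \<subseteq> V \<times> V" "irrefl G"
    and min: "\<And>M'. realizes V d M' \<Longrightarrow> card (sym_diff M G) \<le> card (sym_diff M' G)"
  shows "\<exists>a b :: 'a \<Rightarrow> nat. inj_on b V \<and> (\<forall>x\<in>V. a x < 2 * card V \<and> b x < 2 * card V) \<and>
    (\<forall>(u, v)\<in>M - G. a u < b v) \<and> (\<forall>(u, v)\<in>G - M. b v < a u)"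
proof -
  \<comment> \<open>\<open>Inl\<close> is the tail copy and \<open>Inr\<close> the head copy of a
    vertex, so a directed walk in \<open>D\<close> alternates between arcs of \<open>M - G\<close>
    and reversed arcs of \<open>G - M\<close>.\<close>
  define D :: "('a + 'a) rel" where
    "D = {(Inl u, Inr v) | u v. (u, v) \<in> M - G} \<union> {(Inr v, Inl u) | u v. (u, v) \<in> G - M}"
  have D: "(Inl u, y) \<in> D \<longleftrightarrow> (\<exists>v. y = Inr v \<and> (u, v) \<in> M - G)"
    "(Inr v, y) \<in> D \<longleftrightarrow> (\<exists>u. y = Inl u \<and> (u, v) \<in> G - M)" for u v y
    by (auto simp: D_def)
  have fin: "finite M" "finite G"
    using realizes_finite[OF V M] G V by (auto intro: finite_subset)
  have MV: "M \<subseteq> V \<times> V" "irrefl M" using M by (auto simp: realizes_def)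
  have sink: "\<exists>x\<in>X. \<forall>y\<in>X. (x, y) \<notin> D" if X: "X \<subseteq> V <+> V" "X \<noteq> {}" for X
  proof (rule ccontr)
    assume "\<not> ?thesis"
    then obtain f where f: "\<And>x. x \<in> X \<Longrightarrow> f x \<in> X \<and> (x, f x) \<in> D" by metis
    have "finite X" using X V by (meson finite_Plus finite_subset)
    then obtain Y where Y: "Y \<subseteq> X" "Y \<noteq> {}" "bij_betw f Y Y"
      using finite_self_map_bij[of X f] X f by blast
    have fY: "f x \<in> Y" "(x, f x) \<in> D" if "x \<in> Y" for x
      using that Y f by (auto dest: bij_betwE)
    have inj: "x = y" if "x \<in> Y" "y \<in> Y" "f x = f y" for x y
      using that Y(3) by (auto simp: bij_betw_def inj_on_def)
    have surj: "\<exists>x\<in>Y. f x = y" if "y \<in> Y" for y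
      using that Y(3) unfolding bij_betw_def by (metis imageE)
    \<comment> \<open>\<open>R\<close> and \<open>Q\<close> collect the arcs of \<open>M - G\<close>
      and \<open>G - M\<close> along which \<open>f\<close> moves inside \<open>Y\<close>. Switching
      them will contradict minimality.\<close>
    define R where "R = {(u, v). Inl u \<in> Y \<and> f (Inl u) = Inr v}"
    define Q where "Q = {(u, v). Inr v \<in> Y \<and> f (Inr v) = Inl u}"
    have R: "R \<subseteq> M - G" unfolding R_def using fY(2) D(1) by fastforce
    have Q: "Q \<subseteq> G - M" unfolding Q_def using fY(2) D(2) by fastforce
    have card1: "card Z = of_bool P" if "\<exists>z. P \<longrightarrow> Z = {z}" "\<not> P \<longrightarrow> Z = {}" for Z :: "'a set" and P
      using that by auto
    have fl: "\<exists>v. f (Inl u) = Inr v" if "Inl u \<in> Y" for u using fY(2)[OF that] D(1) by auto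
    have fr: "\<exists>u. f (Inr v) = Inl u" if "Inr v \<in> Y" for v using fY(2)[OF that] D(2) by auto
    have sl: "\<exists>v. Inr v \<in> Y \<and> f (Inr v) = Inl u" if u: "Inl u \<in> Y" for u
    proof -
      obtain x where "x \<in> Y" "f x = Inl u" using surj[OF u] by blast
      then show ?thesis using fl by (cases x) fastforce+
    qed
    have sr: "\<exists>u. Inl u \<in> Y \<and> f (Inl u) = Inr v" if v: "Inr v \<in> Y" for v
    proof -
      obtain x where "x \<in> Y" "f x = Inr v" using surj[OF v] by blast
      then show ?thesis using fr by (cases x) fastforce+
    qed
    \<comment> \<open>As \<open>f\<close> permutes \<open>Y\<close>, every element of
      \<open>Y\<close> is left once and entered once. At \<open>Inl x\<close> one leaves by
      \<open>R\<close> and enters by \<open>Q\<close>; at \<open>Inr x\<close> the other way round.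
      So \<open>R\<close> and \<open>Q\<close> have equal out- and in-degrees.\<close>
    have "outdeg R x = of_bool (Inl x \<in> Y)" for x
      unfolding outdeg_def R_def using fl[of x] by (intro card1) auto
    moreover have "outdeg Q x = of_bool (Inl x \<in> Y)" for x
      unfolding outdeg_def Q_def
    proof (intro card1)
      show "\<exists>z. Inl x \<in> Y \<longrightarrow> {(u, v). Inr v \<in> Y \<and> f (Inr v) = Inl u} `` {x} = {z}"
        using sl[of x] inj by fastforce
    qed (use fY(1) in fastforce)
    moreover have "outdeg (R\<inverse>) x = of_bool (Inr x \<in> Y)" for x
      unfolding outdeg_def R_def
    proof (intro card1)
      show "\<exists>z. Inr x \<in> Y \<longrightarrow> {(u, v). Inl u \<in> Y \<and> f (Inl u) = Inr v}\<inverse> `` {x} = {z}"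
        using sr[of x] inj by fastforce
    qed (use fY(1) in fastforce)
    moreover have "outdeg (Q\<inverse>) x = of_bool (Inr x \<in> Y)" for x
    proof -
      have "Q\<inverse> `` {x} = {u. Inr x \<in> Y \<and> f (Inr x) = Inl u}" by (auto simp: Q_def)
      then show ?thesis unfolding outdeg_def using fr[of x] by (intro card1) auto
    qed
    ultimately have eq: "outdeg R x = outdeg Q x" "outdeg (R\<inverse>) x = outdeg (Q\<inverse>) x" for x
      by simp_all
    let ?M = "(M - R) \<union> Q"
    have finQ: "finite Q" using Q fin by (meson finite_Diff finite_subset)
    have "realizes V d ?M"
      unfolding realizes_def
    proof (intro conjI ballI)
      show "?M \<subseteq> V \<times> V" using MV Q G by auto
      show "irrefl ?M" using MV Q G by (auto simp: irrefl_def)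
      fix x assume "x \<in> V"
      then show "outdeg ?M x = d x" "outdeg (?M\<inverse>) x = d x"
        using outdeg_exchange[of M Q R x] outdeg_converse_exchange[of M Q R x] fin finQ R Q eq[of x] M
        by (auto simp: realizes_def)
    qed
    moreover have "sym_diff ?M G \<subset> sym_diff M G"
    proof -
      obtain y where y: "y \<in> Y" using Y(2) by blast
      have "R \<union> Q \<noteq> {}"
        using y fl fr by (cases y) (fastforce simp: R_def Q_def)+
      then show ?thesis using R Q by blast
    qed
    then have "card (sym_diff ?M G) < card (sym_diff M G)"
      using fin by (intro psubset_card_mono) auto
    ultimately show False using min by (meson leD)
  qed
  have "finite (V <+> V)" using V by simp
  from topological_order[OF this sink] obtain p :: "'a + 'a \<Rightarrow> nat" where p: "inj_on p (V <+> V)"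
    "\<forall>x\<in>V <+> V. p x < card (V <+> V)" "\<forall>x\<in>V <+> V. \<forall>y\<in>V <+> V. (x, y) \<in> D \<longrightarrow> p x < p y"
    by blast
  have card: "card (V <+> V) = 2 * card V" using V by (simp add: card_Plus)
  show ?thesis
  proof (rule exI[of _ "p \<circ> Inl"], rule exI[of _ "p \<circ> Inr"], intro conjI)
    show "inj_on (p \<circ> Inr) V" using p(1) by (auto simp: inj_on_def)
    show "\<forall>x\<in>V. (p \<circ> Inl) x < 2 * card V \<and> (p \<circ> Inr) x < 2 * card V" using p(2) card by auto
    show "\<forall>(u, v)\<in>M - G. (p \<circ> Inl) u < (p \<circ> Inr) v"
    proof clarify
      fix u v assume "(u, v) \<in> M" "(u, v) \<notin> G"
      then have "(Inl u, Inr v) \<in> D" "Inl u \<in> V <+> V" "Inr v \<in> V <+> V" using MV(1) by (auto simp: D)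
      then show "(p \<circ> Inl) u < (p \<circ> Inr) v" using p(3) by simp
    qed
    show "\<forall>(u, v)\<in>G - M. (p \<circ> Inr) v < (p \<circ> Inl) u"
    proof clarify
      fix u v assume "(u, v) \<in> G" "(u, v) \<notin> M"
      then have "(Inr v, Inl u) \<in> D" "Inl u \<in> V <+> V" "Inr v \<in> V <+> V" using G(1) by (auto simp: D)
      then show "(p \<circ> Inr) v < (p \<circ> Inl) u" using p(3) by simp
    qed
  qed
qed

section \<open>Counting arcs of the symmetric difference by weight\<close>

lemma card_inj_near:
  fixes b :: "'a \<Rightarrow> nat" and t :: real
  assumes "inj_on b V" "finite V" "t \<ge> 0"
  shows "real (card {v\<in>V. \<bar>real (b v) - real c\<bar> \<le> t}) \<le> 2 * t + 1"
proof -
  let ?I = "{int c - \<lfloor>t\<rfloor> .. int c + \<lfloor>t\<rfloor>}"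
  have "card {v\<in>V. \<bar>real (b v) - real c\<bar> \<le> t} \<le> card ?I"
  proof (rule card_inj_on_le[where f = "\<lambda>v. int (b v)"])
    show "inj_on (\<lambda>v. int (b v)) {v\<in>V. \<bar>real (b v) - real c\<bar> \<le> t}"
      using assms(1) by (auto simp: inj_on_def)
    show "(\<lambda>v. int (b v)) ` {v\<in>V. \<bar>real (b v) - real c\<bar> \<le> t} \<subseteq> ?I"
    proof clarify
      fix v assume "\<bar>real (b v) - real c\<bar> \<le> t"
      then have "int (b v) - int c \<le> \<lfloor>t\<rfloor>" "int c - int (b v) \<le> \<lfloor>t\<rfloor>"
        by (auto simp: le_floor_iff)
      then show "int (b v) \<in> ?I" by auto
    qed
  qed simp
  moreover have "real (card ?I) = 2 * \<lfloor>t\<rfloor> + 1" using assms(3) by simp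
  moreover have "real_of_int \<lfloor>t\<rfloor> \<le> t" by simp
  ultimately show ?thesis by linarith
qed

text \<open>Grouping arcs by head and by tail shows that the total weight depends on the degrees
  only.\<close>

lemma sum_arc_weights:
  fixes a b :: "'a \<Rightarrow> real"
  assumes "finite V" "R \<subseteq> V \<times> V"
  shows "(\<Sum>(u, v)\<in>R. b v - a u) =
    (\<Sum>x\<in>V. b x * real (outdeg (R\<inverse>) x)) - (\<Sum>x\<in>V. a x * real (outdeg R x))"
proof -
  have finR: "finite R" using assms by (meson finite_SigmaI finite_subset)
  have *: "(\<Sum>(u, v)\<in>R. c u) = (\<Sum>x\<in>V. c x * real (outdeg R x))"
    if "R \<subseteq> V \<times> V" "finite R" for R and c :: "'a \<Rightarrow> real"
  proof -
    have "R = Sigma V (\<lambda>x. R `` {x})" using that by auto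
    then have "(\<Sum>(u, v)\<in>R. c u) = (\<Sum>(u, v)\<in>Sigma V (\<lambda>x. R `` {x}). c u)" by simp
    also have "\<dots> = (\<Sum>x\<in>V. \<Sum>y\<in>R `` {x}. c x)"
      using assms(1) that by (subst sum.Sigma) (auto simp: finite_Image_singleton)
    finally show ?thesis by (simp add: outdeg_def mult.commute)
  qed
  have "(\<Sum>(u, v)\<in>R. b v) = (\<Sum>(u, v)\<in>R\<inverse>. b u)"
    by (rule sum.reindex_bij_witness[of _ prod.swap prod.swap]) auto
  also have "\<dots> = (\<Sum>x\<in>V. b x * real (outdeg (R\<inverse>) x))"
    using assms finR by (intro *) auto
  finally show ?thesis
    using *[of R a] assms finR by (simp add: case_prod_unfold sum_subtractf)
qed

lemma closest_realization_near:
  fixes d :: "'a \<Rightarrow> nat" and G :: "'a rel" and \<epsilon> t :: real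
  assumes V: "finite V" and M: "realizes V d M" and G: "G \<subseteq> V \<times> V" "irrefl G" "sym G"
    and min: "\<And>M'. realizes V d M' \<Longrightarrow> card (sym_diff M G) \<le> card (sym_diff M' G)"
    and dev: "(\<Sum>x\<in>V. \<bar>real (outdeg G x) - real (d x)\<bar>) \<le> \<epsilon>" and t: "t > 0"
  shows "real (card (sym_diff M G)) \<le> real (card V) * (2 * t + 1) + 2 * real (card V) * \<epsilon> / t"
proof -
  obtain a b :: "'a \<Rightarrow> nat" where ab: "inj_on b V"
    "\<forall>x\<in>V. a x < 2 * card V \<and> b x < 2 * card V"
    "\<forall>(u, v)\<in>M - G. a u < b v" "\<forall>(u, v)\<in>G - M. b v < a u"
    using closest_realization_potential[OF V M G(1,2) min] by blast
  have ab': "(u, v) \<in> M - G \<Longrightarrow> a u < b v" "(u, v) \<in> G - M \<Longrightarrow> b v < a u" for u v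
    using ab(3,4) by blast+
  have MV: "M \<subseteq> V \<times> V" using M by (auto simp: realizes_def)
  have fin: "finite M" "finite G" using MV G(1) V by (auto intro: finite_subset)
  define w where "w = (\<lambda>(u, v). real (b v) - real (a u))"
  define \<Delta> where "\<Delta> = sym_diff M G"
  \<comment> \<open>The potentials make \<open>w\<close> positive on \<open>M - G\<close> and
    negative on \<open>G - M\<close>. The common arcs then cancel, leaving a difference of totals
    over \<open>M\<close> and \<open>G\<close>, hence an expression in the degrees.\<close>
  have "(\<Sum>e\<in>\<Delta>. \<bar>w e\<bar>) = (\<Sum>e\<in>M - G. w e) - (\<Sum>e\<in>G - M. w e)"
  proof -
    have "(\<Sum>e\<in>\<Delta>. \<bar>w e\<bar>) = (\<Sum>e\<in>M - G. \<bar>w e\<bar>) + (\<Sum>e\<in>G - M. \<bar>w e\<bar>)"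
      unfolding \<Delta>_def using fin by (intro sum.union_disjoint) auto
    moreover have "(\<Sum>e\<in>M - G. \<bar>w e\<bar>) = (\<Sum>e\<in>M - G. w e)"
      using ab'(1) by (intro sum.cong) (fastforce simp: w_def)+
    moreover have "(\<Sum>e\<in>G - M. \<bar>w e\<bar>) = (\<Sum>e\<in>G - M. - w e)"
      using ab'(2) by (intro sum.cong) (fastforce simp: w_def)+
    ultimately show ?thesis by (simp add: sum_negf)
  qed
  also have "\<dots> = sum w M - sum w G"
    using sum.Int_Diff[of M w G] sum.Int_Diff[of G w M] fin by (simp add: Int_commute)
  also have "\<dots> = (\<Sum>x\<in>V. (real (b x) - real (a x)) * (real (d x) - real (outdeg G x)))"
  proof -
    have "sum w M = (\<Sum>x\<in>V. b x * real (d x)) - (\<Sum>x\<in>V. a x * real (d x))"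
      unfolding w_def using sum_arc_weights[OF V MV, of b a] M by (simp add: realizes_def)
    moreover have "sum w G = (\<Sum>x\<in>V. b x * real (outdeg G x)) - (\<Sum>x\<in>V. a x * real (outdeg G x))"
      unfolding w_def using sum_arc_weights[OF V G(1), of b a] G(3) by (simp add: sym_conv_converse_eq)
    ultimately show ?thesis by (simp add: sum_subtractf[symmetric] algebra_simps)
  qed
  also have "\<dots> \<le> (\<Sum>x\<in>V. 2 * real (card V) * \<bar>real (outdeg G x) - real (d x)\<bar>)"
  proof (rule sum_mono)
    fix x assume "x \<in> V"
    then have "a x < 2 * card V" "b x < 2 * card V" using ab(2) by auto
    then have "\<bar>real (b x) - real (a x)\<bar> \<le> 2 * real (card V)" by linarith
    then have "\<bar>real (b x) - real (a x)\<bar> * \<bar>real (d x) - real (outdeg G x)\<bar>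
        \<le> 2 * real (card V) * \<bar>real (d x) - real (outdeg G x)\<bar>" by (rule mult_right_mono) simp
    then show "(real (b x) - real (a x)) * (real (d x) - real (outdeg G x))
        \<le> 2 * real (card V) * \<bar>real (outdeg G x) - real (d x)\<bar>"
      using abs_ge_self[of "(real (b x) - real (a x)) * (real (d x) - real (outdeg G x))"]
      unfolding abs_mult abs_minus_commute[of "real (outdeg G x)"] by (rule order_trans[rotated])
  qed
  also have "\<dots> \<le> 2 * real (card V) * \<epsilon>"
    unfolding sum_distrib_left[symmetric] using dev by (intro mult_left_mono) auto
  finally have total: "(\<Sum>e\<in>\<Delta>. \<bar>w e\<bar>) \<le> 2 * real (card V) * \<epsilon>" .
  have fin\<Delta>: "finite \<Delta>" using fin by (simp add: \<Delta>_def)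
  \<comment> \<open>Light arcs: for each tail \<open>u\<close>, injectivity of \<open>b\<close>
    allows at most \<open>2 * t + 1\<close> heads. The heavy arcs are bounded by Markov's inequality
    from \<open>total\<close>.\<close>
  define N where "N = {e\<in>\<Delta>. \<bar>w e\<bar> \<le> t}"
  have "real (card N) \<le> real (card V) * (2 * t + 1)"
  proof -
    have "N \<subseteq> Sigma V (\<lambda>u. {v\<in>V. \<bar>real (b v) - real (a u)\<bar> \<le> t})"
      using MV G(1) by (auto simp: N_def \<Delta>_def w_def)
    then have "card N \<le> card (Sigma V (\<lambda>u. {v\<in>V. \<bar>real (b v) - real (a u)\<bar> \<le> t}))"
      using V by (intro card_mono) auto
    then have "card N \<le> (\<Sum>u\<in>V. card {v\<in>V. \<bar>real (b v) - real (a u)\<bar> \<le> t})"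
      using V by (simp add: card_SigmaI)
    then have "real (card N) \<le> (\<Sum>u\<in>V. real (card {v\<in>V. \<bar>real (b v) - real (a u)\<bar> \<le> t}))"
      unfolding of_nat_sum[symmetric] of_nat_le_iff .
    also have "\<dots> \<le> (\<Sum>u\<in>V. 2 * t + 1)"
      using card_inj_near[OF ab(1) V] t by (intro sum_mono) auto
    finally show ?thesis by simp
  qed
  moreover have "real (card (\<Delta> - N)) \<le> 2 * real (card V) * \<epsilon> / t"
  proof -
    have "real (card (\<Delta> - N)) * t = (\<Sum>e\<in>\<Delta> - N. t)" by simp
    also have "\<dots> \<le> (\<Sum>e\<in>\<Delta> - N. \<bar>w e\<bar>)" by (intro sum_mono) (auto simp: N_def)
    also have "\<dots> \<le> (\<Sum>e\<in>\<Delta>. \<bar>w e\<bar>)" using fin\<Delta> by (intro sum_mono2) auto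
    also note total
    finally show ?thesis using t by (simp add: field_simps)
  qed
  moreover have "card \<Delta> = card N + card (\<Delta> - N)"
    using fin\<Delta> card_Un_disjoint[of N "\<Delta> - N"] by (simp add: N_def Un_absorb1)
  ultimately show ?thesis unfolding \<Delta>_def[symmetric] by linarith
qed


section \<open>Undirected graphs as symmetric digraphs\<close>

text \<open>Both orientations of every edge are taken, so degrees agree but each edge counts
  twice.\<close>

definition arcs :: "'a set set \<Rightarrow> 'a rel" where
  "arcs E = {(u, v). {u, v} \<in> E}"

lemma arcs_graph:
  assumes "is_graph_on n E"
  shows "arcs E \<subseteq> {1..n} \<times> {1..n}" "irrefl (arcs E)" "sym (arcs E)" "outdeg (arcs E) i = deg E i"
proof -
  have E: "e \<subseteq> {1..n}" "card e = 2" if "e \<in> E" for e using assms that by (auto simp: is_graph_on_def)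
  show "arcs E \<subseteq> {1..n} \<times> {1..n}" using E(1) by (fastforce simp: arcs_def)
  show "irrefl (arcs E)" using E(2) by (fastforce simp: arcs_def irrefl_def)
  show "sym (arcs E)" by (auto simp: arcs_def sym_def insert_commute)
  have "bij_betw (\<lambda>v. {i, v}) (arcs E `` {i}) {e\<in>E. i \<in> e}"
    unfolding bij_betw_def
  proof
    show "inj_on (\<lambda>v. {i, v}) (arcs E `` {i})" by (auto simp: inj_on_def doubleton_eq_iff)
    have "\<exists>v. e = {i, v}" if "e \<in> E" "i \<in> e" for e
      using E(2)[OF that(1)] that(2) by (auto simp: card_2_iff)
    then show "(\<lambda>v. {i, v}) ` (arcs E `` {i}) = {e\<in>E. i \<in> e}"
      by (fastforce simp: arcs_def)
  qed
  then show "outdeg (arcs E) i = deg E i"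
    unfolding outdeg_def deg_def by (rule bij_betw_same_card)
qed

lemma realizes_arcs:
  assumes "is_graph_on n E" "\<forall>i\<in>{1..n}. deg E i = d i"
  shows "realizes {1..n} d (arcs E)"
  using arcs_graph[OF assms(1)] assms(2) by (simp add: realizes_def sym_conv_converse_eq)

lemma graph_of_sym_digraph:
  assumes "M \<subseteq> {1..n} \<times> {1..n}" "irrefl M" "sym M"
  shows "\<exists>E. is_graph_on n E \<and> arcs E = M"
proof (intro exI conjI)
  let ?E = "(\<lambda>(u, v). {u, v}) ` M"
  show "is_graph_on n ?E"
    using assms unfolding is_graph_on_def irrefl_def by (fastforce simp: card_2_iff)
  show "arcs ?E = M"
    using assms(3) by (auto simp: arcs_def image_iff doubleton_eq_iff dest: symD)
qed

text \<open>Forgetting orientations maps the differing arcs onto the differing edges.\<close>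

lemma card_graph_diff_le:
  assumes "is_graph_on n E" "is_graph_on n E'"
  shows "card (sym_diff E' E) \<le> card (sym_diff (arcs E') (arcs E))"
proof (rule surj_card_le)
  show "finite (sym_diff (arcs E') (arcs E))"
    using arcs_graph(1)[OF assms(1)] arcs_graph(1)[OF assms(2)]
    by (meson finite_Diff finite_UnI finite_SigmaI finite_atLeastAtMost finite_subset)
  show "sym_diff E' E \<subseteq> (\<lambda>(u, v). {u, v}) ` sym_diff (arcs E') (arcs E)"
  proof
    fix e assume e: "e \<in> sym_diff E' E"
    then have "card e = 2" using assms by (auto simp: is_graph_on_def)
    then obtain u v where "e = {u, v}" by (auto simp: card_2_iff)
    with e show "e \<in> (\<lambda>(u, v). {u, v}) ` sym_diff (arcs E') (arcs E)"
      by (intro image_eqI[of _ _ "(u, v)"]) (auto simp: arcs_def)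
  qed
qed

section \<open>Assembling the bounds and choosing the constants\<close>

lemma near_realization:
  fixes \<delta> :: real and n :: nat
  assumes \<delta>: "\<delta> > 0" and n: "real n \<ge> 1 / \<delta>\<^sup>2" and E: "is_graph_on n E" and d: "realizable n d"
    and dev: "(\<Sum>i=1..n. \<bar>real (deg E i) - real (d i)\<bar>) \<le> \<delta> * (real n)\<^sup>2"
  shows "\<exists>E'. is_graph_on n E' \<and> real (card (sym_diff E' E)) \<le> 15 * sqrt \<delta> * (real n)\<^sup>2 \<and>
    (\<forall>i\<in>{1..n}. deg E' i = d i)"
proof -
  let ?V = "{1..n}" and ?G = "arcs E"
  note G = arcs_graph[OF E]
  obtain H where H: "is_graph_on n H" "\<forall>i\<in>?V. deg H i = d i" using d by (auto simp: realizable_def)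
  have rH: "realizes ?V d (arcs H)" using realizes_arcs[OF H] .
  have ev: "even (\<Sum>x\<in>?V. d x)"
  proof -
    have "(\<Sum>x\<in>?V. d x) = card (arcs H)"
      using sum_outdeg[of ?V "arcs H"] rH by (simp add: realizes_def)
    then show ?thesis
      using even_card_sym_irrefl[OF _ arcs_graph(3,2)[OF H(1)]] realizes_finite[OF _ rH] by simp
  qed
  \<comment> \<open>The given realization, read as a digraph, is a candidate, so a closest one
    exists.\<close>
  obtain M where M: "realizes ?V d M"
    "\<And>M'. realizes ?V d M' \<Longrightarrow> card (sym_diff M ?G) \<le> card (sym_diff M' ?G)"
    using ex_has_least_nat[of "realizes ?V d" "arcs H" "\<lambda>M. card (sym_diff M ?G)", OF rH] by blast
  obtain M' where M': "realizes ?V d M'" "sym M'" "card (sym_diff M' M) \<le> 2 * card (M - M\<inverse>)"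
    using symmetrise[OF _ M(1) ev] by auto
  have fin: "finite M" "finite M'" "finite ?G"
    using realizes_finite[OF _ M(1)] realizes_finite[OF _ M'(1)] finite_subset[OF G(1)] by simp_all
  obtain E' where E': "is_graph_on n E'" "arcs E' = M'"
    using graph_of_sym_digraph[of M' n] M' by (auto simp: realizes_def)
  have "\<forall>i\<in>?V. deg E' i = d i"
    using arcs_graph(4)[OF E'(1)] E'(2) M'(1) by (simp add: realizes_def)
  moreover have "real (card (sym_diff E' E)) \<le> 15 * sqrt \<delta> * (real n)\<^sup>2"
  proof -
    \<comment> \<open>This choice balances the light term \<open>n * t\<close> against the heavy
      term \<open>\<delta> * n^3 / t\<close>.\<close>
    define t where "t = sqrt \<delta> * real n"
    have n1: "real n \<ge> 1"
    proof -
      have "real n > 0" using n \<delta> by (smt (verit) zero_less_divide_1_iff zero_less_power)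
      then show ?thesis by simp
    qed
    have t0: "t > 0" unfolding t_def using \<delta> n1 by simp
    \<comment> \<open>The bound on \<open>n\<close> enters here, to absorb the \<open>+ 1\<close> of
      the light count into \<open>n * t\<close>: in total \<open>2 + 1 + 2 = 5\<close>.\<close>
    have t1: "t \<ge> 1"
    proof -
      have "1 \<le> \<delta>\<^sup>2 * real n" using n \<delta> by (simp add: field_simps)
      also have "\<dots> \<le> \<delta>\<^sup>2 * (real n)^4" using n1 by (intro mult_left_mono) (auto simp: self_le_power)
      also have "\<dots> = t^4"
      proof -
        have "(sqrt \<delta>)^4 = ((sqrt \<delta>)\<^sup>2)\<^sup>2" by (simp flip: power_mult)
        then show ?thesis using \<delta> by (simp add: t_def power_mult_distrib)
      qed
      finally show ?thesis using t0 power_less_one_iff[of t 4] by linarith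
    qed
    have "real (card (sym_diff M ?G)) \<le> real n * (2 * t + 1) + 2 * real n * (\<delta> * (real n)\<^sup>2) / t"
      using closest_realization_near[of ?V d M ?G "\<delta> * (real n)\<^sup>2" t] M G dev t0 by simp
    also have "2 * real n * (\<delta> * (real n)\<^sup>2) / t = 2 * real n * t"
    proof -
      have "t * t = \<delta> * (real n)\<^sup>2"
        using \<delta> by (simp add: t_def power_mult_distrib flip: power2_eq_square)
      then have "2 * real n * (\<delta> * (real n)\<^sup>2) / t = 2 * real n * (t * t) / t" by simp
      then show ?thesis using t0 by simp
    qed
    also have "real n * (2 * t + 1) + 2 * real n * t \<le> 5 * (real n * t)"
      using mult_left_mono[OF t1, of "real n"] by (simp add: algebra_simps)
    finally have MG: "real (card (sym_diff M ?G)) \<le> 5 * (real n * t)" .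
    have "card (sym_diff E' E) \<le> card (sym_diff M' ?G)"
      using card_graph_diff_le[OF E E'(1)] E'(2) by simp
    also have "\<dots> \<le> card (sym_diff M' M) + card (sym_diff M ?G)"
      using fin by (intro card_sym_diff_triangle) auto
    \<comment> \<open>Symmetrising costs at most twice the distance from \<open>M\<close> to
      \<open>G\<close>, and that distance itself is added once; hence
      \<open>15 = 3 * 5\<close>.\<close>
    also have "\<dots> \<le> 3 * card (sym_diff M ?G)"
      using M'(3) card_asym_le_sym_diff[OF fin(1,3) G(3)] by simp
    finally have "real (card (sym_diff E' E)) \<le> 3 * real (card (sym_diff M ?G))" by linarith
    then have "real (card (sym_diff E' E)) \<le> 15 * (real n * t)" using MG by linarith
    then show ?thesis by (simp add: t_def power2_eq_square algebra_simps)
  qed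
  ultimately show ?thesis using E'(1) by blast
qed

theorem theorem1p1:
  "\<exists>C::real. C > 0 \<and>
     (\<forall>(\<delta>::real) (n::nat) (E::nat set set) (d::nat \<Rightarrow> nat).
        \<delta> > 0 \<longrightarrow> real n \<ge> 1 / \<delta>\<^sup>2 \<longrightarrow> is_graph_on n E \<longrightarrow> realizable n d \<longrightarrow>
        (\<Sum>i=1..n. \<bar>real (deg E i) - real (d i)\<bar>) \<le> \<delta> * (real n)\<^sup>2 \<longrightarrow>
        (\<exists>E'. is_graph_on n E' \<and>
              real (card ((E' - E) \<union> (E - E'))) \<le> C * sqrt \<delta> * (real n)\<^sup>2 \<and>
              (\<forall>i\<in>{1..n}. deg E' i = d i)))"
  using near_realization by (intro exI[of _ 15]) auto

end
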